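(* Let $\nu$ be a complex number that is not a negative integer. Then there exist polynomials $N_{n,\nu}(q)$, $n\ge1$, in $q$, $q^\nu$ and $[\nu]_q$ with nonnegative integer coefficients such that, as formal power series in $z$, \[ \frac{J_{\nu+1}((1-q)z;q^{-1})}{J_\nu((1-q)z;q^{-1})} = - \sum_{n=1}^{\infty} \frac{N_{n,\nu}(q)}{D_{n,\nu}(q)} q^{(\nu+1)n} z^{2n-1}, \qquad D_{n,\nu}(q) = \prod_{k=1}^n [k+\nu]_q^{\lfloor n/k \rfloor}. \]
   Context: Notation: $(a;p)_n=(1-a)(1-ap)\cdots(1-ap^{n-1})$, $(a;p)_\infty=\prod_{i\ge0}(1-ap^i)$, and $[x]_q=(1-q^x)/(1-q)$. The Hahn–Exton $q$-Bessel function with base $p$ is $J_\nu(w;p)=\frac{(p^{\nu+1};p)_\infty w^\nu}{(p;p)_\infty}\Phi_\nu(w;p)$, where $\Phi_\nu(w;p)=\sum_{n\ge0}\frac{(-1)^n p^{\binom n2}(p w^2)^n}{(p;p)_n(p^{\nu+1};p)_n}$. Consequently $\frac{J_{\nu+1}(w;p)}{J_\nu(w;p)}=\frac{w}{1-p^{\nu+1}}\cdot\frac{\Phi_{\nu+1}(w;p)}{\Phi_\nu(w;p)}$; for base $p=q^{-1}$ the ratio is understood as this formal power series in $w$, whose coefficients are rational functions of $q$ and $q^\nu$. *)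

theory Defs
  imports Complex_Main
    "HOL-Library.Poly_Mapping"
    "HOL-Computational_Algebra.Formal_Power_Series"
begin

text \<open>
  A base \<open>q \<noteq> 0\<close> is given through one of its logarithms \<open>h\<close>, that is \<open>q = exp h\<close>.  This
  makes all complex powers \<open>q\<^sup>x = exp (h * x)\<close> single-valued and mutually consistent, and the
  base \<open>q\<close>-inverse, with the corresponding powers, is given by \<open>- h\<close>.
\<close>

definition qpow :: "complex \<Rightarrow> complex \<Rightarrow> complex" where
  "qpow h x = exp (h * x)"

definition qnum :: "complex \<Rightarrow> complex \<Rightarrow> complex" where
  "qnum h x = (1 - qpow h x) / (1 - exp h)"

definition q_pochhammer :: "complex \<Rightarrow> complex \<Rightarrow> nat \<Rightarrow> complex" where
  "q_pochhammer a p n = (\<Prod>i<n. 1 - a * p ^ i)"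

text \<open>The series \<open>\<Phi>\<^sub>\<nu>(w; p)\<close> for \<open>p = exp h\<close>, as a formal power series in \<open>w\<close>.\<close>

definition hahn_exton_Phi :: "complex \<Rightarrow> complex \<Rightarrow> complex fps" where
  "hahn_exton_Phi h \<nu> =
     (let p = exp h in
       Abs_fps (\<lambda>n. (-1) ^ n * p ^ (n choose 2) * p ^ n /
         (q_pochhammer p p n * q_pochhammer (qpow h (\<nu> + 1)) p n)) oo fps_X ^ 2)"

text \<open>
  The ratio \<open>J\<^bsub>\<nu>+1\<^esub>(w; p) / J\<^sub>\<nu>(w; p)\<close> of Hahn--Exton \<open>q\<close>-Bessel functions with base
  \<open>p = exp h\<close>, as a formal power series in \<open>w\<close>.  The infinite products in the prefactors of the
  two functions need not converge (they do not for \<open>|p| > 1\<close>), but formally their quotient is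
  \<open>w / (1 - p\<^bsup>\<nu>+1\<^esup>)\<close>.
\<close>

definition hahn_exton_ratio :: "complex \<Rightarrow> complex \<Rightarrow> complex fps" where
  "hahn_exton_ratio h \<nu> =
     fps_const (1 / (1 - qpow h (\<nu> + 1))) * fps_X *
       (hahn_exton_Phi h (\<nu> + 1) / hahn_exton_Phi h \<nu>)"

text \<open>
  An element of \<open>(nat \<times> nat \<times> nat) \<Rightarrow>\<^sub>0 nat\<close> is a polynomial in three variables with nonnegative
  integer coefficients, given by its coefficients at the exponent vectors.
\<close>

definition eval_poly3 ::
    "(nat \<times> nat \<times> nat \<Rightarrow>\<^sub>0 nat) \<Rightarrow> complex \<Rightarrow> complex \<Rightarrow> complex \<Rightarrow> complex" where
  "eval_poly3 P x y z =
     (\<Sum>(i, j, k)\<in>Poly_Mapping.keys P.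
        of_nat (Poly_Mapping.lookup P (i, j, k)) * x ^ i * y ^ j * z ^ k)"

definition denom_D :: "nat \<Rightarrow> complex \<Rightarrow> complex \<Rightarrow> complex" where
  "denom_D n h \<nu> = (\<Prod>k=1..n. qnum h (of_nat k + \<nu>) ^ (n div k))"

end

theory Submission
  imports Defs
begin

text \<open>
  Put \<open>t = q\<^bsup>\<nu>+1\<^esup>\<close> and \<open>y = t z\<^sup>2\<close>.  For base \<open>1 / q\<close>, the series \<open>\<Phi>\<^sub>\<nu>\<close> and \<open>\<Phi>\<^bsub>\<nu>+1\<^esub> / [\<nu> + 1]\<close>
  become \<open>A(y)\<close> and \<open>B(y)\<close> with \<open>A(qy) = A(y) + (1 - q) y B(y)\<close> and
  \<open>B(y) - t B(qy) = (1 - q) A(qy)\<close>.  Hence \<open>R = B / A\<close> satisfies a \<open>q\<close>-Riccati equation, whose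
  coefficientwise form can be brought into the subtraction-free shape
  \<open>[\<nu> + n + 1] r\<^sub>n = r\<^sub>0 r\<^bsub>n-1\<^esub> + (\<Sum>i=1..n-1. t q\<^sup>i r\<^sub>i r\<^bsub>n-1-i\<^esub>)\<close>.  Since
  \<open>\<lfloor>i / k\<rfloor> + \<lfloor>j / k\<rfloor> \<le> \<lfloor>(i + j) / k\<rfloor>\<close>, the product \<open>D\<^sub>i D\<^sub>j [\<nu> + i + j]\<close> divides \<open>D\<^bsub>i+j\<^esub>\<close>, with
  cofactor a product of numbers \<open>[k + \<nu>] = (1 + q + \<dots> + q\<^bsup>k-1\<^esup>) + q\<^sup>k [\<nu>]\<close>, so the numerators
  over \<open>D\<close> remain positive.
\<close>

unbundle fps_syntax

section \<open>Polynomials with nonnegative integer coefficients\<close>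

text \<open>
  Nonnegative polynomials are handled as functions; only sums have to be transferred to
  coefficient functions.
\<close>

inductive nonneg_poly3 :: "(complex \<Rightarrow> complex \<Rightarrow> complex \<Rightarrow> complex) \<Rightarrow> bool" where
  zero: "nonneg_poly3 (\<lambda>x y z. 0)"
| monomial: "nonneg_poly3 (\<lambda>x y z. x ^ i * y ^ j * z ^ k)"
| add: "nonneg_poly3 f \<Longrightarrow> nonneg_poly3 g \<Longrightarrow> nonneg_poly3 (\<lambda>x y z. f x y z + g x y z)"

lemma eval_poly3_add: "eval_poly3 (P + Q) x y z = eval_poly3 P x y z + eval_poly3 Q x y z"
proof -
  \<comment> \<open>As a function of key and coefficient the summand is additive in
    \<open>c\<close>, so overlapping supports of \<open>P\<close> and \<open>Q\<close> cause no
    trouble.\<close>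
  define f where "f e c = of_nat c * x ^ fst e * y ^ fst (snd e) * z ^ snd (snd e)"
    for e :: "nat \<times> nat \<times> nat" and c
  have "eval_poly3 R x y z = (\<Sum>e\<in>Poly_Mapping.keys R. f e (Poly_Mapping.lookup R e))" for R
    by (simp add: eval_poly3_def f_def case_prod_unfold)
  then show ?thesis
    using setsum_keys_plus_distrib[of f P Q] by (simp add: f_def algebra_simps)
qed

lemma eval_poly3_of_nonneg_poly3:
  assumes "nonneg_poly3 f"
  shows "\<exists>P. \<forall>x y z. eval_poly3 P x y z = f x y z"
  using assms
proof induction
  case zero
  show ?case by (rule exI[of _ 0]) (simp add: eval_poly3_def)
next
  case (monomial i j k)
  show ?case
    by (rule exI[of _ "Poly_Mapping.single (i, j, k) 1"]) (simp add: eval_poly3_def)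
next
  case (add f g)
  then obtain P Q where "\<forall>x y z. eval_poly3 P x y z = f x y z" "\<forall>x y z. eval_poly3 Q x y z = g x y z"
    by blast
  then show ?case by (intro exI[of _ "P + Q"]) (simp add: eval_poly3_add)
qed

lemma nonneg_poly3_simps:
  "nonneg_poly3 (\<lambda>x y z. 1)" "nonneg_poly3 (\<lambda>x y z. x)"
  "nonneg_poly3 (\<lambda>x y z. y)" "nonneg_poly3 (\<lambda>x y z. z)"
  using monomial[of 0 0 0] monomial[of 1 0 0] monomial[of 0 1 0] monomial[of 0 0 1] by simp_all

lemma nonneg_poly3_sum:
  assumes "\<And>i. i \<in> I \<Longrightarrow> nonneg_poly3 (f i)"
  shows "nonneg_poly3 (\<lambda>x y z. \<Sum>i\<in>I. f i x y z)"
  using assms by (induction I rule: infinite_finite_induct) (auto intro: zero add)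

text \<open>Distributivity in each factor reduces the product to that of two monomials, whose
  exponents add.\<close>

lemma nonneg_poly3_mult:
  assumes "nonneg_poly3 f" "nonneg_poly3 g"
  shows "nonneg_poly3 (\<lambda>x y z. f x y z * g x y z)"
  using assms
proof (induction f)
  case zero
  show ?case by (simp add: nonneg_poly3.zero)
next
  case (monomial i j k)
  from \<open>nonneg_poly3 g\<close> show ?case
  proof induction
    case zero
    show ?case by (simp add: nonneg_poly3.zero)
  next
    case (monomial a b c)
    show ?case
      using nonneg_poly3.monomial[of "i + a" "j + b" "k + c"] by (simp add: power_add mult_ac)
  next
    case (add f g)
    then show ?case by (simp add: distrib_left nonneg_poly3.add)
  qed
next
  case (add f g)
  then show ?case by (simp add: distrib_right nonneg_poly3.add)
qed

lemma nonneg_poly3_power: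
  assumes "nonneg_poly3 f"
  shows "nonneg_poly3 (\<lambda>x y z. f x y z ^ n)"
  by (induction n) (simp_all add: nonneg_poly3_simps nonneg_poly3_mult assms)

lemma nonneg_poly3_prod:
  assumes "\<And>i. i \<in> I \<Longrightarrow> nonneg_poly3 (f i)"
  shows "nonneg_poly3 (\<lambda>x y z. \<Prod>i\<in>I. f i x y z)"
  using assms
  by (induction I rule: infinite_finite_induct) (auto intro: nonneg_poly3_simps nonneg_poly3_mult)

lemmas nonneg_poly3_intros =
  nonneg_poly3_simps nonneg_poly3.add nonneg_poly3_sum nonneg_poly3_mult nonneg_poly3_power
  nonneg_poly3_prod

section \<open>The q-Riccati equation and its coefficients\<close>

text \<open>
  The recurrence coming directly from the two functional equations has the additional term
  \<open>(1 - q) * r $ n\<close>, which is not positive.  It is absorbed into the summand \<open>i = 0\<close> because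
  \<open>(1 - q * t) * r $ 0 = 1 - q\<close>.
\<close>

lemma quotient_recurrence:
  fixes a b r :: "'a::field fps" and q t :: 'a
  assumes a: "a oo (fps_const q * fps_X) = a + fps_const (1 - q) * fps_X * b"
    and b: "b - fps_const t * (b oo (fps_const q * fps_X)) =
              fps_const (1 - q) * (a oo (fps_const q * fps_X))"
    and r: "b = r * a" and a0: "a $ 0 \<noteq> 0"
  shows "(1 - t) * r $ 0 = 1 - q"
    and "(1 - t * q ^ Suc n) * r $ Suc n =
           (1 - q) * (r $ 0 * r $ n + (\<Sum>i=1..n. t * q ^ i * r $ i * r $ (n - i)))"
proof -
  define r' where "r' = r oo (fps_const q * fps_X)"
  define c where "c = fps_const (1 - q)"
  have b': "b oo (fps_const q * fps_X) = r' * (a oo (fps_const q * fps_X))"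
    unfolding r r'_def by (rule fps_compose_mult_distrib) simp
  \<comment> \<open>Since \<open>b = r * a\<close>, the rescaled \<open>a\<close> is a multiple of
    \<open>a\<close> itself, so that \<open>a\<close> can be cancelled from the second functional
    equation.\<close>
  have a': "a oo (fps_const q * fps_X) = (1 + c * fps_X * r) * a"
    unfolding a c_def r by (simp add: algebra_simps)
  have "r * a - fps_const t * (r' * ((1 + c * fps_X * r) * a)) = c * ((1 + c * fps_X * r) * a)"
    using b unfolding b' unfolding a' unfolding r c_def .
  then have "(r - fps_const t * (r' * (1 + c * fps_X * r))) * a = (c * (1 + c * fps_X * r)) * a"
    by (simp add: algebra_simps)
  moreover have "a \<noteq> 0" using a0 by auto
  ultimately have "r - fps_const t * (r' * (1 + c * fps_X * r)) = c * (1 + c * fps_X * r)"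
    by simp
  then have "r = fps_const t * r' + fps_const t * (c * (fps_X * (r' * r))) + c
               + c * (c * (fps_X * r))" (is "_ = ?rhs")
    by (simp add: algebra_simps)
  then have coeff: "r $ m = ?rhs $ m" for m by (rule arg_cong)
  have r'_nth: "r' $ i = q ^ i * r $ i" for i
    unfolding r'_def by (simp add: fps_compose_linear)
  show r0: "(1 - t) * r $ 0 = 1 - q"
    using coeff[of 0] by (simp add: r'_nth c_def algebra_simps)
  have "r $ Suc n = t * (q ^ Suc n * r $ Suc n)
          + t * (1 - q) * (\<Sum>i=0..n. q ^ i * r $ i * r $ (n - i)) + (1 - q) ^ 2 * r $ n"
    using coeff[of "Suc n"]
    by (simp add: r'_nth c_def fps_mult_nth[of r' r] power2_eq_square mult.assoc)
  also have "(\<Sum>i=0..n. q ^ i * r $ i * r $ (n - i)) =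
               r $ 0 * r $ n + (\<Sum>i=1..n. q ^ i * r $ i * r $ (n - i))"
    by (simp add: sum.atLeast_Suc_atMost)
  \<comment> \<open>This term is \<open>1 - t\<close> times \<open>(1 - q) * r $ 0 * r $ n\<close>,
    and the summand split off from the sum is \<open>t\<close> times it; together the weight is
    1.\<close>
  also have "(1 - q) ^ 2 * r $ n = (1 - q) * ((1 - t) * r $ 0) * r $ n"
    by (simp add: r0 power2_eq_square)
  finally show "(1 - t * q ^ Suc n) * r $ Suc n =
           (1 - q) * (r $ 0 * r $ n + (\<Sum>i=1..n. t * q ^ i * r $ i * r $ (n - i)))"
    by (simp add: algebra_simps sum_distrib_left)
qed

section \<open>Powers of q, q-numbers and the denominators D\<close>

lemma qpow_add: "qpow h (x + y) = qpow h x * qpow h y"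
  by (simp add: qpow_def exp_add algebra_simps)

lemma qpow_of_nat: "qpow h (of_nat n) = exp h ^ n"
  by (simp add: qpow_def mult.commute flip: exp_of_nat_mult)

lemma qpow_minus: "qpow (- h) x = inverse (qpow h x)"
  by (simp add: qpow_def exp_minus)

lemma qpow_nonzero [simp]: "qpow h x \<noteq> 0"
  by (simp add: qpow_def)

lemma qnum_of_nat_add:
  assumes "exp h \<noteq> 1"
  shows "qnum h (of_nat n + x) = (\<Sum>i<n. exp h ^ i) + exp h ^ n * qnum h x"
  using assms by (simp add: qnum_def qpow_add qpow_of_nat sum_gp_strict field_simps)

lemma div_add_div_le: "i div k + j div k \<le> (i + j) div (k::nat)"
  by (simp add: div_add1_eq[of i j])

text \<open>The factor with \<open>k = i + j\<close> has exponent 1 in the large product and is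
  absent from the two small ones. All other exponents dominate by \<open>div_add_div_le\<close>, so
  the truncated subtractions are exact.\<close>

lemma denom_D_split:
  assumes "0 < i" "0 < j"
  shows "denom_D (i + j) h \<nu> =
    denom_D i h \<nu> * denom_D j h \<nu> * qnum h (of_nat (i + j) + \<nu>) *
      (\<Prod>k=1..<i + j. qnum h (of_nat k + \<nu>) ^ ((i + j) div k - i div k - j div k))"
proof -
  \<comment> \<open>For \<open>k > l\<close> the exponent \<open>l div k\<close> is 0, so all
    products may run over one range.\<close>
  have ext: "denom_D l h \<nu> = (\<Prod>k=1..<i + j. qnum h (of_nat k + \<nu>) ^ (l div k))"
    if "l < i + j" for l
    unfolding denom_D_def using that by (intro prod.mono_neutral_left) auto
  have "{1..i + j} = insert (i + j) {1..<i + j}"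
    using assms by auto
  then have "denom_D (i + j) h \<nu> = qnum h (of_nat (i + j) + \<nu>) *
      (\<Prod>k=1..<i + j. qnum h (of_nat k + \<nu>) ^ ((i + j) div k))"
    using assms by (simp add: denom_D_def)
  also have "(\<Prod>k=1..<i + j. qnum h (of_nat k + \<nu>) ^ ((i + j) div k)) =
      (\<Prod>k=1..<i + j. qnum h (of_nat k + \<nu>) ^ (i div k) * qnum h (of_nat k + \<nu>) ^ (j div k) *
        qnum h (of_nat k + \<nu>) ^ ((i + j) div k - i div k - j div k))"
    by (intro prod.cong refl) (use div_add_div_le in \<open>simp flip: power_add\<close>)
  also have "\<dots> = denom_D i h \<nu> * denom_D j h \<nu> *
      (\<Prod>k=1..<i + j. qnum h (of_nat k + \<nu>) ^ ((i + j) div k - i div k - j div k))"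
    using assms by (simp add: ext prod.distrib)
  finally show ?thesis by (simp add: mult_ac)
qed

section \<open>The normalised series A and B\<close>

text \<open>This is \<Phi> for base 1/q at \<open>w = (1 - q) z\<close>, written in the variable
  \<open>y = t z^2\<close> with \<open>t = qpow h (\<nu> + 1)\<close>; the powers of
  \<open>1 - q\<close> turn the Pochhammer factors into q-numbers.\<close>

definition bessel_A :: "complex \<Rightarrow> complex \<Rightarrow> complex fps" where
  "bessel_A h \<nu> = Abs_fps (\<lambda>n. (-1) ^ n * exp h ^ (n choose 2) /
     (\<Prod>k=1..n. qnum h (of_nat k) * qnum h (of_nat k + \<nu>)))"

text \<open>By \<open>bessel_A_shift\<close> this is the series A for \<nu> + 1 at
  \<open>q y\<close>, divided by [\<nu> + 1]; the argument \<open>q y\<close> appears because \<nu>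
  + 1 replaces \<open>t\<close> by \<open>t q\<close>.\<close>

definition bessel_B :: "complex \<Rightarrow> complex \<Rightarrow> complex fps" where
  "bessel_B h \<nu> = Abs_fps (\<lambda>n. exp h ^ n * bessel_A h \<nu> $ n / qnum h (of_nat (Suc n) + \<nu>))"

lemma bessel_A_Suc:
  "bessel_A h \<nu> $ Suc n =
    - (exp h ^ n * bessel_A h \<nu> $ n) / (qnum h (of_nat (Suc n)) * qnum h (of_nat (Suc n) + \<nu>))"
proof -
  have "Suc n choose 2 = (n choose 2) + n"
    by (simp add: numeral_2_eq_2)
  then show ?thesis
    by (simp add: bessel_A_def power_add)
qed

lemma bessel_A_0 [simp]: "bessel_A h \<nu> $ 0 = 1"
  by (simp add: bessel_A_def binomial_eq_0)

section \<open>Functional equations of A and B when all [k] and [k + \<nu>] with k \<ge> 1 are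
  nonzero\<close>

context
  fixes h \<nu> :: complex
  assumes q: "\<forall>k::nat\<ge>1. exp h ^ k \<noteq> 1"
    and q_nu: "\<forall>k::nat\<ge>1. qpow h (\<nu> + of_nat k) \<noteq> 1"
begin

lemma q_neq_1: "exp h \<noteq> 1"
  using q[rule_format, of 1] by simp

lemma qnum_of_nat_nonzero: "qnum h (of_nat (Suc k)) \<noteq> 0"
  using q[rule_format, of "Suc k"] q_neq_1 by (simp add: qnum_def qpow_of_nat del: of_nat_Suc)

lemma qnum_shift_nonzero: "qnum h (of_nat (Suc k) + \<nu>) \<noteq> 0"
  using q_nu[rule_format, of "Suc k"] q_neq_1 by (simp add: qnum_def add.commute del: of_nat_Suc)

lemma qnum_of_nat_eq: "(1 - exp h) * qnum h (of_nat k) = 1 - exp h ^ k"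
  using q_neq_1 by (simp add: qnum_def qpow_of_nat)

lemma qnum_shift_eq: "(1 - exp h) * qnum h (of_nat (Suc k) + \<nu>) = 1 - qpow h (\<nu> + 1) * exp h ^ k"
proof -
  have "qpow h (of_nat (Suc k) + \<nu>) = qpow h (\<nu> + 1) * exp h ^ k"
    by (simp only: qpow_of_nat[symmetric] qpow_add[symmetric]) (simp add: add_ac)
  then show ?thesis
    using q_neq_1 by (simp add: qnum_def)
qed

text \<open>The factor \<open>1 - q^(m+1)\<close> equals \<open>(1 - q) [m+1]\<close>, and
  \<open>[m+1]\<close> cancels one denominator of \<open>bessel_A_Suc\<close>, leaving minus the
  coefficient of B.\<close>

lemma bessel_A_compose:
  "bessel_A h \<nu> oo (fps_const (exp h) * fps_X) =
     bessel_A h \<nu> + fps_const (1 - exp h) * fps_X * bessel_B h \<nu>"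
proof (rule fps_ext)
  fix n
  show "(bessel_A h \<nu> oo (fps_const (exp h) * fps_X)) $ n =
     (bessel_A h \<nu> + fps_const (1 - exp h) * fps_X * bessel_B h \<nu>) $ n"
  proof (cases n)
    case (Suc m)
    have "(1 - exp h ^ Suc m) * bessel_A h \<nu> $ Suc m =
      (1 - exp h) * (qnum h (of_nat (Suc m)) * bessel_A h \<nu> $ Suc m)"
      unfolding qnum_of_nat_eq[symmetric] by (simp add: mult_ac)
    also have "qnum h (of_nat (Suc m)) * bessel_A h \<nu> $ Suc m = - bessel_B h \<nu> $ m"
      using qnum_of_nat_nonzero[of m] by (simp add: bessel_A_Suc bessel_B_def del: of_nat_Suc)
    finally show ?thesis
      unfolding Suc fps_compose_linear by (simp add: algebra_simps)
  qed (simp add: fps_compose_linear)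
qed

text \<open>Here \<open>1 - t q^n\<close> equals \<open>(1 - q) [n+1+\<nu>]\<close>, which cancels
  the denominator in \<open>bessel_B\<close>.\<close>

lemma bessel_B_compose:
  "bessel_B h \<nu> - fps_const (qpow h (\<nu> + 1)) * (bessel_B h \<nu> oo (fps_const (exp h) * fps_X)) =
     fps_const (1 - exp h) * (bessel_A h \<nu> oo (fps_const (exp h) * fps_X))"
proof (rule fps_ext)
  fix n
  have "(1 - qpow h (\<nu> + 1) * exp h ^ n) * bessel_B h \<nu> $ n =
     (1 - exp h) * (exp h ^ n * bessel_A h \<nu> $ n)"
    using qnum_shift_nonzero[of n]
    unfolding qnum_shift_eq[symmetric] by (simp add: bessel_B_def del: of_nat_Suc)
  then show "(bessel_B h \<nu> - fps_const (qpow h (\<nu> + 1)) *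
      (bessel_B h \<nu> oo (fps_const (exp h) * fps_X))) $ n =
     (fps_const (1 - exp h) * (bessel_A h \<nu> oo (fps_const (exp h) * fps_X))) $ n"
    unfolding fps_compose_linear by (simp add: algebra_simps)
qed

text \<open>The common factor \<open>1 - q\<close> is divided out of
  \<open>quotient_recurrence\<close>, and \<open>t q^i\<close> is rewritten as
  \<open>q^\<nu> q^(i+1)\<close>, a monomial in the permitted variables.\<close>

lemma bessel_ratio_recurrence:
  fixes r defines "r \<equiv> bessel_B h \<nu> / bessel_A h \<nu>"
  shows "r $ 0 = 1 / qnum h (1 + \<nu>)"
    and "r $ Suc n = (r $ 0 * r $ n +
           (\<Sum>i=1..n. qpow h \<nu> * exp h ^ Suc i * r $ i * r $ (n - i))) /
             qnum h (of_nat (Suc (Suc n)) + \<nu>)"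
proof -
  have r: "bessel_B h \<nu> = r * bessel_A h \<nu>"
    by (simp add: r_def fps_divide_unit mult.assoc inverse_mult_eq_1)
  note rec = quotient_recurrence[OF bessel_A_compose bessel_B_compose r]
  show "r $ 0 = 1 / qnum h (1 + \<nu>)"
    by (simp add: r_def fps_divide_unit bessel_B_def)
  have "(1 - exp h) * (qnum h (of_nat (Suc (Suc n)) + \<nu>) * r $ Suc n) =
      (1 - exp h) * (r $ 0 * r $ n +
           (\<Sum>i=1..n. qpow h (\<nu> + 1) * exp h ^ i * r $ i * r $ (n - i)))"
    using rec(2)[of n] by (simp add: qnum_shift_eq flip: mult.assoc del: of_nat_Suc)
  then have "qnum h (of_nat (Suc (Suc n)) + \<nu>) * r $ Suc n =
      r $ 0 * r $ n + (\<Sum>i=1..n. qpow h (\<nu> + 1) * exp h ^ i * r $ i * r $ (n - i))"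
    using q_neq_1 by (subst (asm) mult_left_cancel) simp_all
  moreover have "qpow h (\<nu> + 1) * exp h ^ i = qpow h \<nu> * exp h ^ Suc i" for i
    by (simp add: qpow_add) (simp add: qpow_def)
  ultimately have "qnum h (of_nat (Suc (Suc n)) + \<nu>) * r $ Suc n =
      r $ 0 * r $ n + (\<Sum>i=1..n. qpow h \<nu> * exp h ^ Suc i * r $ i * r $ (n - i))"
    by (simp only:)
  then show "r $ Suc n = (r $ 0 * r $ n +
           (\<Sum>i=1..n. qpow h \<nu> * exp h ^ Suc i * r $ i * r $ (n - i))) /
             qnum h (of_nat (Suc (Suc n)) + \<nu>)"
    using qnum_shift_nonzero[of "Suc n"] by (metis nonzero_mult_div_cancel_left)
qed

lemma denom_D_nonzero: "denom_D n h \<nu> \<noteq> 0"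
proof -
  have "qnum h (of_nat k + \<nu>) \<noteq> 0" if "k \<ge> 1" for k
    using qnum_shift_nonzero[of "k - 1"] that by simp
  then show ?thesis by (simp add: denom_D_def)
qed

text \<open>Inverting the base uses \<open>1 - 1/x = -(1 - x)/x\<close> on both new Pochhammer
  factors; the power of \<open>1 - exp h\<close> comes from \<open>w = (1 - q) z\<close>.\<close>

lemma Phi_coeff:
  "(-1) ^ n * exp (- h) ^ (n choose 2) * exp (- h) ^ n /
     (q_pochhammer (exp (- h)) (exp (- h)) n * q_pochhammer (qpow (- h) (\<nu> + 1)) (exp (- h)) n) *
     (1 - exp h) ^ (2 * n) = qpow h (\<nu> + 1) ^ n * bessel_A h \<nu> $ n" (is "?L n = ?R n")
proof (induction n)
  case 0
  then show ?case by (simp add: q_pochhammer_def binomial_eq_0)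
next
  case (Suc n)
  define Q where "Q = exp h"
  define t where "t = qpow h (\<nu> + 1)"
  \<comment> \<open>Thus \<open>Q * u\<close> is \<open>q^(n+1)\<close> and \<open>t * u\<close> is
    \<open>q^(\<nu>+n+1)\<close>, the two quantities in the new factors.\<close>
  define u where "u = Q ^ n"
  have nz: "Q \<noteq> 0" "t \<noteq> 0" "u \<noteq> 0" by (simp_all add: Q_def t_def u_def)
  have ne: "1 - Q * u \<noteq> 0" "1 - t * u \<noteq> 0" "1 - Q \<noteq> 0"
    using q[rule_format, of "Suc n"] qnum_shift_nonzero[of n] qnum_shift_eq[of n] q_neq_1
    by (auto simp: Q_def t_def u_def simp del: of_nat_Suc)
  have "Suc n choose 2 = (n choose 2) + n"
    by (simp add: numeral_2_eq_2)
  then have "?L (Suc n) = ?L n * (- (1 - Q)\<^sup>2 / (Q * u) /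
      ((1 - inverse Q * inverse u) * (1 - inverse t * inverse u)))"
    by (simp add: q_pochhammer_def power_add exp_minus qpow_minus Q_def u_def t_def
        power2_eq_square power_inverse divide_inverse mult_ac)
  also have "- (1 - Q)\<^sup>2 / (Q * u) / ((1 - inverse Q * inverse u) * (1 - inverse t * inverse u)) =
      - (t * u) * (1 - Q)\<^sup>2 / ((1 - Q * u) * (1 - t * u))"
    using nz ne by (simp add: divide_simps) (simp add: algebra_simps)
  also have "\<dots> = - (t * u) / (qnum h (of_nat (Suc n)) * qnum h (of_nat (Suc n) + \<nu>))"
  proof -
    have "1 - Q * u = (1 - Q) * qnum h (of_nat (Suc n))"
      "1 - t * u = (1 - Q) * qnum h (of_nat (Suc n) + \<nu>)"
      by (simp_all only: Q_def t_def u_def qnum_of_nat_eq qnum_shift_eq power_Suc)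
    then show ?thesis
      using ne by (simp add: power2_eq_square mult_ac del: of_nat_Suc)
  qed
  finally have step: "?L (Suc n) = ?L n *
      (- (t * u) / (qnum h (of_nat (Suc n)) * qnum h (of_nat (Suc n) + \<nu>)))" .
  show ?case
    unfolding step Suc.IH bessel_A_Suc by (simp add: Q_def u_def t_def mult_ac del: of_nat_Suc)
qed

end

section \<open>Transfer to the Hahn-Exton ratio\<close>

text \<open>The products of \<open>[k+1+\<nu>]\<close> and of \<open>[k+\<nu>]\<close> over k = 1..n
  differ only in their end factors \<open>[n+1+\<nu>]\<close> and \<open>[1+\<nu>]\<close>.\<close>

lemma bessel_A_shift:
  assumes q: "\<forall>k::nat\<ge>1. exp h ^ k \<noteq> 1" and q_nu: "\<forall>k::nat\<ge>1. qpow h (\<nu> + of_nat k) \<noteq> 1"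
  shows "exp h ^ n * bessel_A h (\<nu> + 1) $ n = qnum h (1 + \<nu>) * bessel_B h \<nu> $ n"
proof -
  note nz = qnum_of_nat_nonzero[OF q q_nu] qnum_shift_nonzero[OF q q_nu]
  have "qnum h (of_nat (Suc n) + \<nu>) * bessel_A h (\<nu> + 1) $ n = qnum h (1 + \<nu>) * bessel_A h \<nu> $ n"
  proof (induction n)
    case (Suc n)
    have shift: "of_nat (Suc n) + (\<nu> + 1) = of_nat (Suc (Suc n)) + \<nu>"
      by simp
    have "qnum h (of_nat (Suc (Suc n)) + \<nu>) * bessel_A h (\<nu> + 1) $ Suc n =
        - (exp h ^ n * (qnum h (of_nat (Suc n) + \<nu>) * bessel_A h (\<nu> + 1) $ n)) /
          (qnum h (of_nat (Suc n)) * qnum h (of_nat (Suc n) + \<nu>))"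
      using nz[of n] nz(2)[of "Suc n"] unfolding bessel_A_Suc shift by (simp del: of_nat_Suc)
    then show ?case
      by (simp add: Suc.IH bessel_A_Suc mult_ac del: of_nat_Suc)
  qed simp
  then show ?thesis
    using nz[of n] by (simp add: bessel_B_def field_simps del: of_nat_Suc)
qed

lemma fps_nth_compose_X_squared:
  "(f oo fps_X ^ 2) $ n = (if even n then f $ (n div 2) else (0::'a::comm_ring_1))"
proof -
  have "(f oo fps_X ^ 2) $ n = (\<Sum>i=0..n. if n = 2 * i then f $ i else 0)"
    by (auto simp: fps_compose_nth simp flip: power_mult intro!: sum.cong)
  also have "\<dots> = (\<Sum>i=0..n. if even n \<and> i = n div 2 then f $ i else 0)"
    by (intro sum.cong) auto
  finally show ?thesis by auto
qed

lemma hahn_exton_Phi_compose: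
  assumes "\<forall>k::nat\<ge>1. exp h ^ k \<noteq> 1" "\<forall>k::nat\<ge>1. qpow h (\<nu> + of_nat k) \<noteq> 1"
  shows "hahn_exton_Phi (- h) \<nu> oo (fps_const (1 - exp h) * fps_X) =
    (bessel_A h \<nu> oo (fps_const (qpow h (\<nu> + 1)) * fps_X)) oo fps_X ^ 2"
proof (rule fps_ext)
  fix n
  show "(hahn_exton_Phi (- h) \<nu> oo (fps_const (1 - exp h) * fps_X)) $ n =
    ((bessel_A h \<nu> oo (fps_const (qpow h (\<nu> + 1)) * fps_X)) oo fps_X ^ 2) $ n"
  proof (cases "even n")
    case True
    then obtain k where "n = 2 * k" ..
    then show ?thesis
      using Phi_coeff[OF assms, of k, unfolded mult.commute[of _ "(1 - exp h) ^ (2 * k)"]]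
      by (simp add: hahn_exton_Phi_def Let_def fps_nth_compose_X_squared)
  qed (simp add: hahn_exton_Phi_def Let_def fps_nth_compose_X_squared)
qed

text \<open>The scalars collapse: \<open>(1 - q) [\<nu>+1]\<close> is \<open>1 - t\<close>, and
  dividing it by the prefactor's \<open>1 - 1/t\<close> gives \<open>- t\<close>.\<close>

lemma hahn_exton_ratio_compose:
  assumes q: "\<forall>k::nat\<ge>1. exp h ^ k \<noteq> 1" and q_nu: "\<forall>k::nat\<ge>1. qpow h (\<nu> + of_nat k) \<noteq> 1"
  shows "hahn_exton_ratio (- h) \<nu> oo (fps_const (1 - exp h) * fps_X) =
    - fps_const (qpow h (\<nu> + 1)) * fps_X *
      (((bessel_B h \<nu> / bessel_A h \<nu>) oo (fps_const (qpow h (\<nu> + 1)) * fps_X)) oo fps_X ^ 2)"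
proof -
  define t where "t = qpow h (\<nu> + 1)"
  define X where "X = fps_const (1 - exp h) * fps_X"
  define Y where "Y = fps_const t * fps_X"
  have q_nu': "\<forall>k::nat\<ge>1. qpow h (\<nu> + 1 + of_nat k) \<noteq> 1"
  proof (intro allI impI)
    fix k :: nat
    show "qpow h (\<nu> + 1 + of_nat k) \<noteq> 1"
      using q_nu[rule_format, of "Suc k"] by (simp add: add_ac)
  qed
  have t_shift: "qpow h (\<nu> + 1 + 1) = t * exp h"
    unfolding t_def qpow_add[of h "\<nu> + 1" 1] by (simp add: qpow_def)
  have "bessel_A h (\<nu> + 1) oo (fps_const (t * exp h) * fps_X) =
      fps_const (qnum h (1 + \<nu>)) * (bessel_B h \<nu> oo Y)"
    unfolding Y_def
    by (rule fps_ext) (simp add: power_mult_distrib mult.assoc bessel_A_shift[OF q q_nu])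
  then have num: "hahn_exton_Phi (- h) (\<nu> + 1) oo X =
      fps_const (qnum h (1 + \<nu>)) * ((bessel_B h \<nu> oo Y) oo fps_X ^ 2)"
    unfolding X_def hahn_exton_Phi_compose[OF q q_nu'] t_shift
    by (simp add: fps_compose_mult_distrib)
  have den: "hahn_exton_Phi (- h) \<nu> oo X = (bessel_A h \<nu> oo Y) oo fps_X ^ 2"
    unfolding X_def Y_def t_def by (rule hahn_exton_Phi_compose[OF q q_nu])
  have "(hahn_exton_Phi (- h) \<nu> oo X) $ 0 = 1"
    unfolding den by simp
  then have Phi0: "hahn_exton_Phi (- h) \<nu> $ 0 \<noteq> 0"
    by simp
  have ratio: "(bessel_B h \<nu> oo Y) oo fps_X ^ 2 =
      (((bessel_B h \<nu> / bessel_A h \<nu>) oo Y) oo fps_X ^ 2) * ((bessel_A h \<nu> oo Y) oo fps_X ^ 2)"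
  proof -
    have "bessel_B h \<nu> = bessel_B h \<nu> / bessel_A h \<nu> * bessel_A h \<nu>"
      by (simp add: fps_divide_unit mult.assoc inverse_mult_eq_1)
    then have "bessel_B h \<nu> oo Y = ((bessel_B h \<nu> / bessel_A h \<nu>) oo Y) * (bessel_A h \<nu> oo Y)"
      by (metis Y_def fps_compose_mult_distrib fps_mult_nth_0 fps_X_nth mult_zero_right zero_neq_one)
    then show ?thesis
      by (simp add: fps_compose_mult_distrib)
  qed
  \<comment> \<open>Division commutes with the substitution because the constant term of the
    denominator is nonzero.\<close>
  have quot: "(hahn_exton_Phi (- h) (\<nu> + 1) / hahn_exton_Phi (- h) \<nu>) oo X =
      fps_const (qnum h (1 + \<nu>)) * (((bessel_B h \<nu> / bessel_A h \<nu>) oo Y) oo fps_X ^ 2)"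
  proof -
    have "(bessel_A h \<nu> oo Y) oo fps_X ^ 2 \<noteq> 0"
      using den Phi0 by (metis fps_compose_nth_0 fps_zero_nth)
    moreover have "(hahn_exton_Phi (- h) (\<nu> + 1) / hahn_exton_Phi (- h) \<nu>) oo X =
        (hahn_exton_Phi (- h) (\<nu> + 1) oo X) / (hahn_exton_Phi (- h) \<nu> oo X)"
      using Phi0 by (intro fps_divide_compose) (simp add: X_def)
    ultimately show ?thesis
      by (simp add: num den ratio flip: mult.assoc)
  qed
  have t: "t \<noteq> 0" "1 - t \<noteq> 0"
    using q_nu[rule_format, of 1] by (simp_all add: t_def)
  have "(1 - exp h) * qnum h (1 + \<nu>) = 1 - t"
    using q_neq_1[OF q q_nu] by (simp add: qnum_def t_def add.commute)
  moreover have "1 / (1 - inverse t) * (1 - t) = - t"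
    using t by (simp add: field_simps)
  ultimately have scalar: "1 / (1 - inverse t) * (1 - exp h) * qnum h (1 + \<nu>) = - t"
    by (simp only: mult.assoc)
  have "hahn_exton_ratio (- h) \<nu> oo X = fps_const (1 / (1 - inverse t)) * X *
      ((hahn_exton_Phi (- h) (\<nu> + 1) / hahn_exton_Phi (- h) \<nu>) oo X)"
    by (simp add: hahn_exton_ratio_def qpow_minus t_def fps_compose_mult_distrib X_def)
  also have "\<dots> = fps_const (1 / (1 - inverse t) * (1 - exp h) * qnum h (1 + \<nu>)) * fps_X *
      (((bessel_B h \<nu> / bessel_A h \<nu>) oo Y) oo fps_X ^ 2)"
    unfolding quot by (simp only: X_def fps_const_mult[symmetric] mult_ac)
  finally show ?thesis
    unfolding scalar by (simp add: X_def Y_def t_def)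
qed

section \<open>Positivity of the numerators\<close>

text \<open>The polynomial is chosen before \<open>h\<close> and \<nu>. Strong induction applies,
  since the recurrence and the cofactors from \<open>denom_D_split\<close> are free of
  subtractions.\<close>

lemma bessel_ratio_numerator:
  "\<exists>f. nonneg_poly3 f \<and> (\<forall>h \<nu>.
     (\<forall>k::nat\<ge>1. exp h ^ k \<noteq> 1) \<longrightarrow> (\<forall>k::nat\<ge>1. qpow h (\<nu> + of_nat k) \<noteq> 1) \<longrightarrow>
       (bessel_B h \<nu> / bessel_A h \<nu>) $ n =
         f (exp h) (qpow h \<nu>) (qnum h \<nu>) / denom_D (Suc n) h \<nu>)"
proof (induction n rule: less_induct)
  case (less n)
  show ?case
  proof (cases n)
    case 0
    show ?thesis
      using 0 by (intro exI[of _ "\<lambda>x y z. 1"])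
        (auto simp: nonneg_poly3_simps bessel_ratio_recurrence(1) denom_D_def simp del: fps_divide_nth_0)
  next
    case (Suc m)
    obtain f where f: "\<And>i. i \<le> m \<Longrightarrow> nonneg_poly3 (f i)"
      and f_eq: "\<And>i h \<nu>. i \<le> m \<Longrightarrow> \<forall>k::nat\<ge>1. exp h ^ k \<noteq> 1 \<Longrightarrow>
        \<forall>k::nat\<ge>1. qpow h (\<nu> + of_nat k) \<noteq> 1 \<Longrightarrow>
        (bessel_B h \<nu> / bessel_A h \<nu>) $ i =
          f i (exp h) (qpow h \<nu>) (qnum h \<nu>) / denom_D (Suc i) h \<nu>"
      using less.IH unfolding Suc less_Suc_eq_le by metis
    \<comment> \<open>The cofactor of \<open>denom_D_split\<close> for the indices
      \<open>Suc i\<close> and \<open>Suc (m - i)\<close>, which add up to \<open>Suc n\<close>;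
      each \<open>[k + \<nu>]\<close> is expanded by \<open>qnum_of_nat_add\<close> into a
      polynomial in q and [\<nu>].\<close>
    define c where "c i x y z = (\<Prod>k=1..<Suc n. ((\<Sum>j<k. x ^ j) + x ^ k * z) ^
        (Suc n div k - Suc i div k - Suc (m - i) div k))" for i and x y z :: complex
    \<comment> \<open>The summand for \<open>i = 0\<close> stands apart because its weight is 1, not
      \<open>y * x\<close>.\<close>
    define g where "g x y z = f 0 x y z * f m x y z * c 0 x y z +
        (\<Sum>i=1..m. y * x ^ Suc i * f i x y z * f (m - i) x y z * c i x y z)" for x y z
    have "nonneg_poly3 (c i)" for i
      unfolding c_def by (intro nonneg_poly3_intros)
    then have "nonneg_poly3 g"
      unfolding g_def by (intro nonneg_poly3_intros f) auto
    moreover have "(bessel_B h \<nu> / bessel_A h \<nu>) $ n =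
         g (exp h) (qpow h \<nu>) (qnum h \<nu>) / denom_D (Suc n) h \<nu>"
      if q: "\<forall>k::nat\<ge>1. exp h ^ k \<noteq> 1" and q_nu: "\<forall>k::nat\<ge>1. qpow h (\<nu> + of_nat k) \<noteq> 1" for h \<nu>
    proof -
      define r where "r = bessel_B h \<nu> / bessel_A h \<nu>"
      define F where "F i = f i (exp h) (qpow h \<nu>) (qnum h \<nu>)" for i
      define C where "C i = c i (exp h) (qpow h \<nu>) (qnum h \<nu>)" for i
      define s where "s = qnum h (of_nat (Suc n) + \<nu>)"
      have split: "r $ i * r $ (m - i) / s = F i * F (m - i) * C i / denom_D (Suc n) h \<nu>"
        if "i \<le> m" for i
      proof -
        have n: "Suc i + Suc (m - i) = Suc n"
          using that Suc by simp
        have "C i = (\<Prod>k=1..<Suc n. qnum h (of_nat k + \<nu>) ^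
                (Suc n div k - Suc i div k - Suc (m - i) div k))"
          using q_neq_1[OF q q_nu] by (simp add: C_def c_def qnum_of_nat_add)
        then have D: "denom_D (Suc n) h \<nu> = denom_D (Suc i) h \<nu> * denom_D (Suc (m - i)) h \<nu> * s * C i"
          using denom_D_split[of "Suc i" "Suc (m - i)" h \<nu>] unfolding n s_def by simp
        \<comment> \<open>As a factor of the nonzero denominator, the cofactor may be
          cancelled.\<close>
        then have "C i \<noteq> 0"
          using denom_D_nonzero[OF q q_nu, of "Suc n"] by auto
        then show ?thesis
          using that f_eq[OF _ q q_nu, of i] f_eq[OF _ q q_nu, of "m - i"]
          by (simp add: D r_def F_def)
      qed
      have "r $ n = (r $ 0 * r $ m +
           (\<Sum>i=1..m. qpow h \<nu> * exp h ^ Suc i * r $ i * r $ (m - i))) / s"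
        using bessel_ratio_recurrence(2)[OF q q_nu, of m] by (simp only: r_def s_def Suc)
      also have "\<dots> = r $ 0 * r $ (m - 0) / s +
           (\<Sum>i=1..m. qpow h \<nu> * exp h ^ Suc i * (r $ i * r $ (m - i) / s))"
        by (simp add: add_divide_distrib sum_divide_distrib mult.assoc)
      also have "\<dots> = F 0 * F (m - 0) * C 0 / denom_D (Suc n) h \<nu> +
           (\<Sum>i=1..m. qpow h \<nu> * exp h ^ Suc i * (F i * F (m - i) * C i / denom_D (Suc n) h \<nu>))"
        by (intro arg_cong2[of _ _ _ _ "(+)"] sum.cong refl) (simp_all only: split atLeastAtMost_iff le0)
      also have "\<dots> = g (exp h) (qpow h \<nu>) (qnum h \<nu>) / denom_D (Suc n) h \<nu>"
        by (simp add: g_def F_def C_def add_divide_distrib sum_divide_distrib mult.assoc)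
      finally show ?thesis
        by (simp only: r_def)
    qed
    ultimately show ?thesis by blast
  qed
qed

theorem theorem1p3:
  fixes \<nu> :: complex
  assumes "\<forall>k::nat\<ge>1. \<nu> \<noteq> - of_nat k"
  shows "\<exists>N :: nat \<Rightarrow> (nat \<times> nat \<times> nat \<Rightarrow>\<^sub>0 nat).
    \<forall>h :: complex.
      (\<forall>k::nat\<ge>1. exp h ^ k \<noteq> 1) \<longrightarrow>
      (\<forall>k::nat\<ge>1. qpow h (\<nu> + of_nat k) \<noteq> 1) \<longrightarrow>
      hahn_exton_ratio (- h) \<nu> oo (fps_const (1 - exp h) * fps_X) =
        - Abs_fps (\<lambda>m. if odd m then
            (let n = (m + 1) div 2 in
              eval_poly3 (N n) (exp h) (qpow h \<nu>) (qnum h \<nu>) / denom_D n h \<nu>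
                * qpow h ((\<nu> + 1) * of_nat n))
          else 0)"
proof -
  have "\<exists>P. \<forall>h. (\<forall>k::nat\<ge>1. exp h ^ k \<noteq> 1) \<longrightarrow> (\<forall>k::nat\<ge>1. qpow h (\<nu> + of_nat k) \<noteq> 1) \<longrightarrow>
      (bessel_B h \<nu> / bessel_A h \<nu>) $ n =
        eval_poly3 P (exp h) (qpow h \<nu>) (qnum h \<nu>) / denom_D (Suc n) h \<nu>" for n
    using bessel_ratio_numerator[of n] eval_poly3_of_nonneg_poly3 by metis
  then obtain P where P: "\<And>n h. \<forall>k::nat\<ge>1. exp h ^ k \<noteq> 1 \<Longrightarrow>
      \<forall>k::nat\<ge>1. qpow h (\<nu> + of_nat k) \<noteq> 1 \<Longrightarrow>
      (bessel_B h \<nu> / bessel_A h \<nu>) $ n =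
        eval_poly3 (P n) (exp h) (qpow h \<nu>) (qnum h \<nu>) / denom_D (Suc n) h \<nu>"
    by metis
  show ?thesis
  \<comment> \<open>The coefficient of index \<open>n - 1\<close> of B / A belongs to
    \<open>z^(2n-1)\<close>, whence the shift; odd exponents only use n \<ge> 1.\<close>
  proof (intro exI[of _ "\<lambda>n. P (n - 1)"] allI impI fps_ext)
    fix h m
    assume q: "\<forall>k::nat\<ge>1. exp h ^ k \<noteq> 1" and q_nu: "\<forall>k::nat\<ge>1. qpow h (\<nu> + of_nat k) \<noteq> 1"
    have t: "qpow h ((\<nu> + 1) * of_nat n) = qpow h (\<nu> + 1) ^ n" for n
      by (simp add: qpow_def mult_ac flip: exp_of_nat_mult)
    show "(hahn_exton_ratio (- h) \<nu> oo (fps_const (1 - exp h) * fps_X)) $ m =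
        (- Abs_fps (\<lambda>m. if odd m then
            (let n = (m + 1) div 2 in
              eval_poly3 (P (n - 1)) (exp h) (qpow h \<nu>) (qnum h \<nu>) / denom_D n h \<nu>
                * qpow h ((\<nu> + 1) * of_nat n))
          else 0)) $ m"
    proof (cases m)
      case 0
      then show ?thesis by (simp add: hahn_exton_ratio_compose[OF q q_nu])
    next
      \<comment> \<open>For \<open>l = 2 k\<close> the prefactor \<open>- t z\<close> and the
        \<open>t^k\<close> from \<open>y^k\<close> combine to \<open>- t^(k+1)\<close>; for odd
        \<open>l\<close> both sides vanish.\<close>
      case (Suc l)
      then show ?thesis
        by (auto simp: hahn_exton_ratio_compose[OF q q_nu] mult.assoc fps_nth_compose_X_squared
            P[OF q q_nu] Let_def t elim!: evenE)
    qed
  qed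
qed

end
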